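(* Let $(X,\Sigma_X,\mu)$ be a measure space with $\mu$ a positive measure and $\mu(X)<+\infty$. (1) Let $f,g:X\to\mathbb{R}$ be two integrable, $\mu$-a.e. correlated functions such that $fg$ is integrable, with $\Sigma_X=\sigma(f,g)$. Then $$\mu(X)\int_X fg\,\mathrm{d}\mu \ \ge\ \int_X f\,\mathrm{d}\mu\int_X g\,\mathrm{d}\mu .$$ Moreover, if $f$ and $g$ are summable, then equality holds in this inequality if and only if at least one of the functions $f,g$ is $\mu$-a.e. constant. (2) Let $k$ be a positive integer and let $\{f_i\}_{i=1}^k$ be a family of measurable functions $f_i:X\to\mathbb{R}$ which are nonnegative and $\mu$-a.e. correlated, with $\Sigma_X=\sigma(f_i:\ i=1,\dots,k)$. Then $$\mu(X)^{k-1}\int_X\prod_{i=1}^k f_i\,\mathrm{d}\mu\ \ge\ \prod_{i=1}^k\int_X f_i\,\mathrm{d}\mu .$$ Moreover, if $\int_X f_i\,\mathrm{d}\mu\in(0,+\infty)$ for all $i=1,\dots,k$, then equality holds in this inequality if and only if at least $k-1$ of the functions $f_1,\dots,f_k$ are $\mu$-a.e. constant.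
   Context: Correlated functions: a family $\{f_i\}_{i\in\Gamma}$ of real functions on a set $X$ is correlated if for all $i\in\Gamma$ and $x,y\in X$, $f_i(x)>f_i(y)$ implies $f_j(x)\ge f_j(y)$ for all $j\in\Gamma$; equivalently, $(f_i(x)-f_i(y))(f_j(x)-f_j(y))\ge 0$ for all $i,j\in\Gamma$ and $x,y\in X$. The family is $\mu$-a.e. correlated if there is a $\mu$-null set $N$ such that this holds for all $x,y\in X\setminus N$. Integrable vs. summable: a measurable function $g:X\to\mathbb{R}$ is called integrable if at least one of $\int g^+\,\mathrm{d}\mu$, $\int g^-\,\mathrm{d}\mu$ is finite, where $g^+=\max(g,0)$ and $g^-=-\min(g,0)$; then $\int g\,\mathrm{d}\mu:=\int g^+\,\mathrm{d}\mu-\int g^-\,\mathrm{d}\mu\in[-\infty,+\infty]$. It is called summable if both integrals are finite. Conventions: $\pm\infty+z=\pm\infty$ for $z\in\mathbb{R}$ and $0\cdot(\pm\infty)=0$. $\sigma(f_i:i\in\Gamma)$ denotes the smallest $\sigma$-algebra making all $f_i$ measurable. *)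

theory Defs
  imports "HOL-Analysis.Analysis"
begin

text \<open>A family of functions is represented by the set of its members: correlation and the
  generated sigma-algebra do not depend on the indexing.\<close>

definition correlated_on :: "'a set \<Rightarrow> ('a \<Rightarrow> real) set \<Rightarrow> bool" where
  "correlated_on X F \<longleftrightarrow>
     (\<forall>f\<in>F. \<forall>x\<in>X. \<forall>y\<in>X. f x > f y \<longrightarrow> (\<forall>g\<in>F. g x \<ge> g y))"

definition AE_correlated :: "'a measure \<Rightarrow> ('a \<Rightarrow> real) set \<Rightarrow> bool" where
  "AE_correlated M F \<longleftrightarrow> (\<exists>N\<in>null_sets M. correlated_on (space M - N) F)"

definition AE_constant :: "'a measure \<Rightarrow> ('a \<Rightarrow> real) \<Rightarrow> bool" where
  "AE_constant M f \<longleftrightarrow> (\<exists>c. AE x in M. f x = c)"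

definition generated_sigma :: "'a set \<Rightarrow> ('a \<Rightarrow> real) set \<Rightarrow> 'a set set" where
  "generated_sigma X F = sigma_sets X {f -` B \<inter> X | f B. f \<in> F \<and> B \<in> sets borel}"

text \<open>``Integrable'' in the weak sense that at most one of the integrals of the positive and
  the negative part is infinite. When both are finite (``summable''), this is the library's
  \<^const>\<open>integrable\<close>.\<close>

definition ext_integrable :: "'a measure \<Rightarrow> ('a \<Rightarrow> real) \<Rightarrow> bool" where
  "ext_integrable M g \<longleftrightarrow> g \<in> borel_measurable M \<and>
     ((\<integral>\<^sup>+ x. ennreal (max (g x) 0) \<partial>M) < \<infinity> \<or> (\<integral>\<^sup>+ x. ennreal (- min (g x) 0) \<partial>M) < \<infinity>)"

text \<open>Only meaningful under \<^const>\<open>ext_integrable\<close>, which excludes \<open>\<infinity> - \<infinity>\<close>.\<close>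

definition ext_integral :: "'a measure \<Rightarrow> ('a \<Rightarrow> real) \<Rightarrow> ereal" where
  "ext_integral M g =
     enn2ereal (\<integral>\<^sup>+ x. ennreal (max (g x) 0) \<partial>M) -
     enn2ereal (\<integral>\<^sup>+ x. ennreal (- min (g x) 0) \<partial>M)"

end

theory Submission
  imports Defs
begin

text \<open>For correlated \<open>f, g\<close> and almost all \<open>x, y\<close> we have
  \<open>0 \<le> (f x - f y) (g x - g y)\<close>, and integrating first in \<open>x\<close>, then in \<open>y\<close> gives Chebyshev's
  inequality. In the equality case the product vanishes for almost all \<open>y\<close> and almost all \<open>x\<close>,
  which is impossible if neither function is almost everywhere constant. If \<open>\<integral>f = \<infinity>\<close> and
  \<open>\<integral>g \<ge> 0\<close> with \<open>g\<close> not null, some good point \<open>w\<close> has \<open>f w > 0\<close> and \<open>g w > 0\<close>, and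
  \<open>f x * g x \<ge> g w * f x + f w * g x - f w * g w\<close> forces \<open>\<integral>f g = \<infinity>\<close>; the other infinite cases
  follow by symmetry and by passing to \<open>-f, -g\<close>. For several nonnegative functions one
  multiplies them together one at a time, since \<open>f g\<close> remains correlated with the rest of the
  family; two nonconstant members, if multiplied first, make the inequality strict.\<close>

section \<open>Correlated families and the operations that preserve correlation\<close>

lemma correlated_on_pairD:
  assumes "correlated_on S F" "f \<in> F" "g \<in> F" "x \<in> S" "y \<in> S"
  shows "f x * g y + f y * g x \<le> f x * g x + f y * g y"
proof -
  have "0 \<le> (f x - f y) * (g x - g y)"
    using assms unfolding correlated_on_def zero_le_mult_iff by (smt (verit, best))
  then show ?thesis by (simp add: algebra_simps)
qed

lemma AE_correlatedE:
  assumes "AE_correlated M F"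
  obtains S where "AE x in M. x \<in> S" "correlated_on S F"
proof -
  obtain N where N: "N \<in> null_sets M" "correlated_on (space M - N) F"
    using assms unfolding AE_correlated_def by blast
  have "AE x in M. x \<in> space M - N"
    using AE_not_in[OF N(1)] AE_space by eventually_elim simp
  then show thesis using that[of "space M - N"] N by blast
qed

lemma AE_correlated_mono:
  assumes "AE_correlated M F" "G \<subseteq> F"
  shows "AE_correlated M G"
  using assms unfolding AE_correlated_def correlated_on_def by (meson subsetD)

text \<open>The quantifiers are nested, so integrating first in \<open>x\<close> and then in
  \<open>y\<close> takes the place of a product measure. All terms are written as sums, so the
  inequality also makes sense in \<open>ennreal\<close>.\<close>

lemma AE_correlated_pairD:
  assumes "AE_correlated M {f, g}"
  shows "AE y in M. AE x in M. f x * g y + f y * g x \<le> f x * g x + f y * g y"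
proof -
  obtain S where S: "AE x in M. x \<in> S" "correlated_on S {f, g}"
    using AE_correlatedE[OF assms] .
  show ?thesis
    using S(1)
  proof eventually_elim
    case (elim y)
    show ?case
      using S(1) by eventually_elim (use correlated_on_pairD[OF S(2)] elim in auto)
  qed
qed

lemma AE_correlated_uminus:
  assumes "AE_correlated M {f, g}"
  shows "AE_correlated M {\<lambda>x. - f x, \<lambda>x. - g x}"
proof -
  obtain N where N: "N \<in> null_sets M" "correlated_on (space M - N) {f, g}"
    using assms unfolding AE_correlated_def by blast
  \<comment> \<open>Negation reverses both comparisons, so the condition at \<open>(x, y)\<close>
    becomes the original one at \<open>(y, x)\<close>.\<close>
  from N(2) have "correlated_on (space M - N) {\<lambda>x. - f x, \<lambda>x. - g x}"
    unfolding correlated_on_def by (simp only: ball_simps neg_less_iff_less neg_le_iff_le) blast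
  with N(1) show ?thesis unfolding AE_correlated_def by blast
qed

text \<open>If some \<open>h\<close> in \<open>F\<close> increases strictly, both factors increase
  weakly and, being nonnegative, so does their product (\<open>up\<close>). If the product increases
  strictly, one factor must do so, and it carries all of \<open>F\<close> along
  (\<open>down\<close>).\<close>

lemma AE_correlated_mult:
  assumes corr: "AE_correlated M (insert f (insert g F))"
    and nonneg: "\<And>x. x \<in> space M \<Longrightarrow> 0 \<le> f x" "\<And>x. x \<in> space M \<Longrightarrow> 0 \<le> g x"
  shows "AE_correlated M (insert (\<lambda>x. f x * g x) F)"
proof -
  obtain N where N: "N \<in> null_sets M" "correlated_on (space M - N) (insert f (insert g F))"
    using corr unfolding AE_correlated_def by blast
  let ?S = "space M - N"
  have c: "h' y \<le> h' x"
    if "h \<in> insert f (insert g F)" "h' \<in> insert f (insert g F)" "x \<in> ?S" "y \<in> ?S" "h y < h x"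
    for h h' x y
    using N(2) that unfolding correlated_on_def by blast
  have up: "f y * g y \<le> f x * g x" if "h \<in> F" "x \<in> ?S" "y \<in> ?S" "h y < h x" for h x y
    using c[of h f x y] c[of h g x y] that nonneg by (intro mult_mono) auto
  have down: "h y \<le> h x" if "h \<in> F" "x \<in> ?S" "y \<in> ?S" "f y * g y < f x * g x" for h x y
  proof -
    have "f y < f x \<or> g y < g x"
      using that nonneg by (metis DiffD1 linorder_not_le mult_mono)
    then show ?thesis using c[of f h x y] c[of g h x y] that by blast
  qed
  have "correlated_on ?S (insert (\<lambda>x. f x * g x) F)"
    unfolding correlated_on_def
  proof (intro ballI impI)
    fix u v x y
    assume *: "u \<in> insert (\<lambda>x. f x * g x) F" "v \<in> insert (\<lambda>x. f x * g x) F"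
      "x \<in> ?S" "y \<in> ?S" "u y < u x"
    show "v y \<le> v x"
      using * up down c[of u v x y] by (smt (verit) insert_iff)
  qed
  then show ?thesis using N(1) unfolding AE_correlated_def by blast
qed

section \<open>Chebyshev's inequality for two functions, and its equality case for summable
  ones\<close>

lemma nn_integral_correlated:
  assumes corr: "AE_correlated M {f, g}"
    and [measurable]: "f \<in> borel_measurable M" "g \<in> borel_measurable M"
    and nonneg: "\<And>x. x \<in> space M \<Longrightarrow> 0 \<le> f x" "\<And>x. x \<in> space M \<Longrightarrow> 0 \<le> g x"
  shows "(\<integral>\<^sup>+ x. ennreal (f x) \<partial>M) * (\<integral>\<^sup>+ x. ennreal (g x) \<partial>M)
    \<le> emeasure M (space M) * (\<integral>\<^sup>+ x. ennreal (f x * g x) \<partial>M)"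
proof -
  let ?I = "\<lambda>h. \<integral>\<^sup>+ x. ennreal (h x) \<partial>M" and ?m = "emeasure M (space M)"
  let ?fg = "\<lambda>x. f x * g x"
  \<comment> \<open>This is the pair inequality integrated in \<open>x\<close> for fixed
    \<open>y\<close>. Every term stays on the side where it is nonnegative, so infinite integrals
    are allowed.\<close>
  have "AE y in M. ennreal (g y) * ?I f + ennreal (f y) * ?I g \<le> ?I ?fg + ennreal (?fg y) * ?m"
    using AE_correlated_pairD[OF corr] AE_space
  proof eventually_elim
    case (elim y)
    have "ennreal (g y) * ?I f + ennreal (f y) * ?I g
        = (\<integral>\<^sup>+ x. ennreal (g y) * ennreal (f x) + ennreal (f y) * ennreal (g x) \<partial>M)"
      by (simp add: nn_integral_add nn_integral_cmult)
    also have "\<dots> \<le> (\<integral>\<^sup>+ x. ennreal (?fg x) + ennreal (?fg y) \<partial>M)"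
    proof (rule nn_integral_mono_AE)
      show "AE x in M. ennreal (g y) * ennreal (f x) + ennreal (f y) * ennreal (g x)
          \<le> ennreal (?fg x) + ennreal (?fg y)"
        using elim(1) AE_space
        by eventually_elim
          (use nonneg elim(2) in \<open>simp add: ennreal_mult'[symmetric] ennreal_plus[symmetric]
             ennreal_leI mult.commute del: ennreal_plus\<close>)
    qed
    also have "\<dots> = ?I ?fg + ennreal (?fg y) * ?m"
      by (simp add: nn_integral_add)
    finally show ?case .
  qed
  then have "(\<integral>\<^sup>+ y. ennreal (g y) * ?I f + ennreal (f y) * ?I g \<partial>M)
      \<le> (\<integral>\<^sup>+ y. ?I ?fg + ennreal (?fg y) * ?m \<partial>M)"
    by (rule nn_integral_mono_AE)
  \<comment> \<open>By symmetry in \<open>f\<close> and \<open>g\<close>, integrating in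
    \<open>y\<close> gives twice the wanted quantity on each side. The factor 2 can be cancelled in
    \<open>ennreal\<close>, being neither zero nor infinite.\<close>
  moreover have "(\<integral>\<^sup>+ y. ennreal (g y) * ?I f + ennreal (f y) * ?I g \<partial>M) = 2 * (?I f * ?I g)"
    by (simp add: nn_integral_add nn_integral_multc mult_2 mult.commute)
  moreover have "(\<integral>\<^sup>+ y. ?I ?fg + ennreal (?fg y) * ?m \<partial>M) = 2 * (?m * ?I ?fg)"
    by (simp add: nn_integral_add nn_integral_multc mult_2) (simp add: mult.commute)
  ultimately have "2 * (?I f * ?I g) \<le> 2 * (?m * ?I ?fg)"
    by simp
  then show ?thesis
    by (simp add: ennreal_mult_le_mult_iff)
qed

lemma (in finite_measure) integral_correlated:
  assumes corr: "AE_correlated M {f, g}"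
    and [simp]: "integrable M f" "integrable M g" "integrable M (\<lambda>x. f x * g x)"
  shows "(\<integral>x. f x \<partial>M) * (\<integral>x. g x \<partial>M) \<le> measure M (space M) * (\<integral>x. f x * g x \<partial>M)"
    and "(\<integral>x. f x \<partial>M) * (\<integral>x. g x \<partial>M) = measure M (space M) * (\<integral>x. f x * g x \<partial>M)
      \<Longrightarrow> AE_constant M f \<or> AE_constant M g"
proof -
  let ?m = "measure M (space M)"
  \<comment> \<open>\<open>?P y x\<close> is \<open>(f x - f y) * (g x - g y)\<close> in expanded
    form, so that the integrals in \<open>x\<close> and then in \<open>y\<close> follow by
    linearity.\<close>
  let ?P = "\<lambda>y x. f x * g x + f y * g y - (f x * g y + f y * g x)"
  define H where "H y = (\<integral>x. ?P y x \<partial>M)" for y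
  have P_int: "integrable M (?P y)" for y by simp
  have H_eq: "H = (\<lambda>y. (\<integral>x. f x * g x \<partial>M) + ?m * (f y * g y)
      - ((\<integral>x. f x \<partial>M) * g y + f y * (\<integral>x. g x \<partial>M)))"
    unfolding H_def by (simp add: fun_eq_iff)
  have H_nonneg: "AE y in M. 0 \<le> H y"
    using AE_correlated_pairD[OF corr] unfolding H_def
    by eventually_elim (intro integral_nonneg_AE, simp)
  have H_int: "integrable M H" unfolding H_eq by simp
  have H_integral: "(\<integral>y. H y \<partial>M)
      = 2 * (?m * (\<integral>x. f x * g x \<partial>M) - (\<integral>x. f x \<partial>M) * (\<integral>x. g x \<partial>M))"
    unfolding H_eq by simp
  show "(\<integral>x. f x \<partial>M) * (\<integral>x. g x \<partial>M) \<le> ?m * (\<integral>x. f x * g x \<partial>M)"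
    using integral_nonneg_AE[OF H_nonneg] unfolding H_integral by simp
  assume eq: "(\<integral>x. f x \<partial>M) * (\<integral>x. g x \<partial>M) = ?m * (\<integral>x. f x * g x \<partial>M)"
  \<comment> \<open>Equality makes the integral of the nonnegative \<open>H\<close> vanish. The same
    argument applied to \<open>?P y\<close> then shows that the product of differences is zero
    almost everywhere.\<close>
  have "AE y in M. H y = 0"
    using integral_nonneg_eq_0_iff_AE[OF H_int H_nonneg] eq unfolding H_integral by simp
  then have zero: "AE y in M. AE x in M. f x = f y \<or> g x = g y"
    using AE_correlated_pairD[OF corr]
  proof eventually_elim
    case (elim y)
    have "AE x in M. ?P y x = 0"
      using elim integral_nonneg_eq_0_iff_AE[OF P_int, of y] by (simp add: H_def)
    then show ?case
    proof eventually_elim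
      case (elim x)
      then have "(f x - f y) * (g x - g y) = 0" by (simp add: algebra_simps)
      then show ?case by auto
    qed
  qed
  show "AE_constant M f \<or> AE_constant M g"
  proof (rule ccontr)
    assume nc: "\<not> (AE_constant M f \<or> AE_constant M g)"
    \<comment> \<open>If no such \<open>y\<close> existed, \<open>zero\<close> would fail at every
      point. The space would then be null, and every function almost everywhere constant.\<close>
    have "\<exists>y. AE x in M. f x = f y \<or> g x = g y"
    proof (rule ccontr)
      assume "\<not> ?thesis"
      then have "AE y in M. False" using zero by simp
      then have "AE x in M. f x = 0" by eventually_elim simp
      then show False using nc unfolding AE_constant_def by blast
    qed
    then obtain y where y: "AE x in M. f x = f y \<or> g x = g y" by blast
    \<comment> \<open>If \<open>f z\<close> differs from \<open>f y\<close>, then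
      \<open>g z = g y\<close>. Almost every \<open>x\<close> then satisfies
      \<open>g x = g y\<close>, since otherwise \<open>f x\<close> would equal both
      \<open>f y\<close> and \<open>f z\<close>; so \<open>g\<close> would be constant.\<close>
    have "AE z in M. f z = f y"
      using y zero
    proof eventually_elim
      case (elim z)
      show ?case
      proof (rule ccontr)
        assume "f z \<noteq> f y"
        have "AE x in M. g x = g y"
          using y elim(2) by eventually_elim (use elim(1) \<open>f z \<noteq> f y\<close> in auto)
        then show False using nc unfolding AE_constant_def by blast
      qed
    qed
    then show False using nc unfolding AE_constant_def by blast
  qed
qed

lemma (in finite_measure) AE_constant_integrals:
  assumes const: "AE_constant M f"
    and [measurable]: "f \<in> borel_measurable M"
    and g: "integrable M g"
  shows "integrable M (\<lambda>x. f x * g x)"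
    "measure M (space M) * (\<integral>x. f x * g x \<partial>M) = (\<integral>x. f x \<partial>M) * (\<integral>x. g x \<partial>M)"
proof -
  note [measurable] = borel_measurable_integrable[OF g]
  obtain c where c: "AE x in M. f x = c" using const unfolding AE_constant_def by blast
  then have c': "AE x in M. f x * g x = c * g x" by eventually_elim simp
  have "integrable M (\<lambda>x. c * g x)" using g by simp
  then show "integrable M (\<lambda>x. f x * g x)" using c' by (subst integrable_cong_AE[OF _ _ c']) auto
  have "(\<integral>x. f x \<partial>M) = (\<integral>x. c \<partial>M)" using c by (intro integral_cong_AE) auto
  moreover have "(\<integral>x. f x * g x \<partial>M) = (\<integral>x. c * g x \<partial>M)" using c' by (intro integral_cong_AE) auto
  ultimately show "measure M (space M) * (\<integral>x. f x * g x \<partial>M) = (\<integral>x. f x \<partial>M) * (\<integral>x. g x \<partial>M)" by simp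
qed

section \<open>Extended integrals: finite, plus infinity or minus infinity\<close>

lemma ennreal_max_0: "ennreal (max x 0) = ennreal x"
  by (simp add: max_def ennreal_neg)

lemma ennreal_neg_min_0: "ennreal (- min x 0) = ennreal (- x)"
  by (simp add: min_def ennreal_neg)

text \<open>Since \<open>ennreal\<close> sends negative reals to 0, \<open>ennreal (g x)\<close> and
  \<open>ennreal (- g x)\<close> already are the positive and the negative part.\<close>

lemma ext_integral_alt:
  "ext_integral M g = enn2ereal (\<integral>\<^sup>+ x. ennreal (g x) \<partial>M) - enn2ereal (\<integral>\<^sup>+ x. ennreal (- g x) \<partial>M)"
  by (simp add: ext_integral_def ennreal_neg_min_0 ennreal_max_0)

lemma ext_integrable_alt:
  "ext_integrable M g \<longleftrightarrow> g \<in> borel_measurable M \<and>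
     ((\<integral>\<^sup>+ x. ennreal (g x) \<partial>M) < \<infinity> \<or> (\<integral>\<^sup>+ x. ennreal (- g x) \<partial>M) < \<infinity>)"
  by (simp add: ext_integrable_def ennreal_neg_min_0 ennreal_max_0)

lemma ext_integral_integrable:
  assumes "integrable M g"
  shows "ext_integral M g = ereal (\<integral>x. g x \<partial>M)"
proof -
  have e: "enn2ereal a = ereal (enn2real a)" if "a \<noteq> \<infinity>" for a
    using that by (cases a) auto
  show ?thesis
    using assms unfolding ext_integral_alt real_lebesgue_integral_def[OF assms]
    by (simp add: real_integrable_def e)
qed

text \<open>In \<open>ereal\<close>, \<open>\<infinity> - \<infinity>\<close> is
  \<open>\<infinity>\<close>, so exchanging the two parts would not change the sign there. Weak
  integrability rules this case out.\<close>

lemma ext_integral_uminus: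
  assumes "ext_integrable M g"
  shows "ext_integrable M (\<lambda>x. - g x)" "ext_integral M (\<lambda>x. - g x) = - ext_integral M g"
proof -
  show "ext_integrable M (\<lambda>x. - g x)" using assms by (auto simp: ext_integrable_alt)
  show "ext_integral M (\<lambda>x. - g x) = - ext_integral M g"
    using assms unfolding ext_integral_alt ext_integrable_alt
    by (cases "enn2ereal (\<integral>\<^sup>+ x. ennreal (g x) \<partial>M)"; cases "enn2ereal (\<integral>\<^sup>+ x. ennreal (- g x) \<partial>M)") auto
qed

lemma ext_integral_cases:
  assumes "ext_integrable M g"
  obtains
    (integrable) "integrable M g"
  | (PInf) "ext_integral M g = \<infinity>" "(\<integral>\<^sup>+ x. ennreal (g x) \<partial>M) = \<infinity>" "(\<integral>\<^sup>+ x. ennreal (- g x) \<partial>M) < \<infinity>"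
  | (MInf) "ext_integral M g = - \<infinity>" "(\<integral>\<^sup>+ x. ennreal (- g x) \<partial>M) = \<infinity>" "(\<integral>\<^sup>+ x. ennreal (g x) \<partial>M) < \<infinity>"
proof -
  let ?p = "\<integral>\<^sup>+ x. ennreal (g x) \<partial>M" and ?n = "\<integral>\<^sup>+ x. ennreal (- g x) \<partial>M"
  have fin: "\<exists>r. enn2ereal a = ereal r" if "a < \<infinity>" for a
    using that by (cases a) auto
  consider "?p < \<infinity>" "?n < \<infinity>" | "?p = \<infinity>" "?n < \<infinity>" | "?n = \<infinity>" "?p < \<infinity>"
    using assms by (cases "?p = \<infinity>"; cases "?n = \<infinity>") (auto simp: ext_integrable_alt less_top)
  then show thesis
  proof cases
    case 1
    then show thesis using integrable assms by (simp add: ext_integrable_alt real_integrable_def less_top)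
  next
    case 2
    then show thesis using PInf fin[OF 2(2)] by (auto simp: ext_integral_alt)
  next
    case 3
    then show thesis using MInf fin[OF 3(2)] by (auto simp: ext_integral_alt)
  qed
qed

lemma AE_null_space:
  assumes "emeasure M (space M) = 0"
  shows "AE x in M. P x"
  by (rule AE_I'[of "space M"]) (use assms in \<open>auto simp: null_sets_def\<close>)

lemma ext_integrableD: "ext_integrable M f \<Longrightarrow> f \<in> borel_measurable M"
  by (simp add: ext_integrable_def)

lemma integrable_pos_part:
  assumes "f \<in> borel_measurable M" "(\<integral>\<^sup>+ x. ennreal (f x) \<partial>M) < \<infinity>"
  shows "integrable M (\<lambda>x. max (f x) 0 :: real)"
  using assms by (intro integrableI_bounded) (auto simp: ennreal_max_0)

text \<open>An upper bound alone suffices because \<open>ennreal\<close> only sees the positive part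
  of \<open>f\<close>.\<close>

lemma nn_integral_less_top_of_bound:
  assumes "integrable M u" "AE x in M. f x \<le> (u x :: real)"
  shows "(\<integral>\<^sup>+ x. ennreal (f x) \<partial>M) < \<infinity>"
proof -
  have "(\<integral>\<^sup>+ x. ennreal (f x) \<partial>M) \<le> (\<integral>\<^sup>+ x. ennreal (u x) \<partial>M)"
    using assms(2) by (intro nn_integral_mono_AE) (auto elim: eventually_mono intro: ennreal_leI)
  also have "\<dots> < \<infinity>" using assms(1) by (simp add: real_integrable_def less_top)
  finally show ?thesis .
qed

section \<open>The two-function inequality when some integrals are infinite\<close>

context finite_measure
begin

text \<open>The negative part of \<open>h\<close> is controlled by those of \<open>f\<close> and
  \<open>g\<close> and a constant, which is integrable as the measure is finite. Were the positive
  part of \<open>h\<close> also summable, solving the minorant for \<open>f\<close> (dividing by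
  \<open>a > 0\<close>) would bound \<open>f\<close> by an integrable function.\<close>

lemma ext_integral_affine_minorant:
  assumes [measurable]: "f \<in> borel_measurable M" "g \<in> borel_measurable M" "h \<in> borel_measurable M"
    and le: "AE x in M. a * f x + b * g x - c \<le> h x"
    and ab: "0 < a" "0 < b"
    and f: "(\<integral>\<^sup>+ x. ennreal (f x) \<partial>M) = \<infinity>" "(\<integral>\<^sup>+ x. ennreal (- f x) \<partial>M) < \<infinity>"
    and g: "(\<integral>\<^sup>+ x. ennreal (- g x) \<partial>M) < \<infinity>"
  shows "ext_integral M h = \<infinity>"
proof -
  have parts: "- a * f x \<le> a * max (- f x) 0" "- b * g x \<le> b * max (- g x) 0" for x
    using ab by (auto simp: max_def mult_le_0_iff)
  note [simp] = integrable_pos_part[OF _ f(2)] integrable_pos_part[OF _ g]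
  have "AE x in M. - h x \<le> a * max (- f x) 0 + b * max (- g x) 0 + \<bar>c\<bar>"
    using le
  proof eventually_elim
    case (elim x)
    then show ?case using parts[of x] by simp
  qed
  then have neg: "(\<integral>\<^sup>+ x. ennreal (- h x) \<partial>M) < \<infinity>"
    by (rule nn_integral_less_top_of_bound[rotated]) simp
  have "(\<integral>\<^sup>+ x. ennreal (h x) \<partial>M) = \<infinity>"
  proof (rule ccontr)
    assume "\<not> ?thesis"
    then have [simp]: "integrable M (\<lambda>x. max (h x) 0)"
      by (intro integrable_pos_part) (auto simp: less_top)
    have "AE x in M. f x \<le> (max (h x) 0 + b * max (- g x) 0 + \<bar>c\<bar>) / a"
      using le
    proof eventually_elim
      case (elim x)
      then show ?case using parts(2)[of x] ab by (simp add: pos_le_divide_eq mult.commute)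
    qed
    then have "(\<integral>\<^sup>+ x. ennreal (f x) \<partial>M) < \<infinity>"
      by (rule nn_integral_less_top_of_bound[rotated]) simp
    then show False using f(1) by simp
  qed
  with neg show ?thesis
    by (cases "\<integral>\<^sup>+ x. ennreal (- h x) \<partial>M") (auto simp: ext_integral_alt)
qed

lemma ext_integral_mult_PInf:
  assumes corr: "AE_correlated M {f, g}"
    and [measurable]: "f \<in> borel_measurable M" "g \<in> borel_measurable M"
    and f: "(\<integral>\<^sup>+ x. ennreal (f x) \<partial>M) = \<infinity>" "(\<integral>\<^sup>+ x. ennreal (- f x) \<partial>M) < \<infinity>"
    and g: "(\<integral>\<^sup>+ x. ennreal (- g x) \<partial>M) < \<infinity>" "\<not> (AE x in M. g x \<le> 0)"
  shows "ext_integral M (\<lambda>x. f x * g x) = \<infinity>"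
proof -
  obtain S where S: "AE x in M. x \<in> S" "correlated_on S {f, g}"
    using AE_correlatedE[OF corr] .
  obtain y where y: "y \<in> S" "0 < f y"
  proof -
    have "\<exists>y\<in>S. 0 < f y"
    proof (rule ccontr)
      assume "\<not> ?thesis"
      then have "AE x in M. ennreal (f x) = 0"
        using S(1) by (auto elim!: eventually_mono simp: ennreal_eq_0_iff not_less)
      then have "(\<integral>\<^sup>+ x. ennreal (f x) \<partial>M) = 0" by (simp add: nn_integral_0_iff_AE)
      then show False using f(1) by simp
    qed
    then show thesis using that by blast
  qed
  obtain z where z: "z \<in> S" "0 < g z"
  proof -
    have "\<exists>y\<in>S. 0 < g y"
    proof (rule ccontr)
      assume "\<not> ?thesis"
      then have "AE x in M. g x \<le> 0"
        using S(1) by (auto elim!: eventually_mono simp: not_less)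
      then show False using g(2) by simp
    qed
    then show thesis using that by blast
  qed
  \<comment> \<open>If \<open>g y\<close> is not positive, then \<open>g y < g z\<close>, and
    correlation gives \<open>f z\<close> at least \<open>f y\<close>, which is positive; so
    \<open>z\<close> serves instead.\<close>
  obtain w where w: "w \<in> S" "0 < f w" "0 < g w"
  proof (cases "0 < g y")
    case True
    then show thesis using that y by blast
  next
    case False
    then have "f y \<le> f z" using S(2) y z unfolding correlated_on_def by fastforce
    then show thesis using that[of z] y z by simp
  qed
  have "AE x in M. g w * f x + f w * g x - f w * g w \<le> f x * g x"
    using S(1)
  proof eventually_elim
    case (elim x)
    show ?case
      using correlated_on_pairD[OF S(2) _ _ elim w(1), of f g] by (simp add: algebra_simps)
  qed
  then show ?thesis
    using w f g by (intro ext_integral_affine_minorant[of f g _ "g w" "f w" "f w * g w"]) auto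
qed

text \<open>With one suitable \<open>y\<close> fixed, the pair inequality bounds the product below
  by an integrable combination of \<open>f\<close>, \<open>g\<close> and a constant, which excludes
  the value minus infinity. If no \<open>y\<close> were suitable, the space would be null and the
  integral of the negative part zero.\<close>

lemma ext_integral_mult_integrable_cases:
  assumes corr: "AE_correlated M {f, g}"
    and fg: "integrable M f" "integrable M g" "ext_integrable M (\<lambda>x. f x * g x)"
  shows "integrable M (\<lambda>x. f x * g x) \<or> ext_integral M (\<lambda>x. f x * g x) = \<infinity>"
  using fg(3)
proof (cases rule: ext_integral_cases)
  case MInf
  have "\<exists>y. AE x in M. f x * g y + f y * g x \<le> f x * g x + f y * g y"
  proof (rule ccontr)
    assume "\<not> ?thesis"
    then have "AE x in M. False" using AE_correlated_pairD[OF corr] by simp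
    then have "(\<integral>\<^sup>+ x. ennreal (- (f x * g x)) \<partial>M) = (\<integral>\<^sup>+ x. 0 \<partial>M)"
      by (intro nn_integral_cong_AE) (auto elim: eventually_mono)
    then show False using MInf(2) by simp
  qed
  then obtain y where "AE x in M. f x * g y + f y * g x \<le> f x * g x + f y * g y" by blast
  then have "AE x in M. - (f x * g x) \<le> f y * g y - (f x * g y + f y * g x)"
    by eventually_elim simp
  then have "(\<integral>\<^sup>+ x. ennreal (- (f x * g x)) \<partial>M) < \<infinity>"
    by (rule nn_integral_less_top_of_bound[rotated]) (simp add: fg)
  then show ?thesis using MInf by simp
qed auto

lemma ext_integral_correlated_PInf:
  assumes corr: "AE_correlated M {f, g}"
    and fg: "ext_integrable M f" "ext_integrable M g"
    and f: "ext_integral M f = \<infinity>"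
  shows "ext_integral M f * ext_integral M g
    \<le> enn2ereal (emeasure M (space M)) * ext_integral M (\<lambda>x. f x * g x)"
proof -
  note [measurable] = ext_integrableD[OF fg(1)] ext_integrableD[OF fg(2)]
  let ?fg = "\<lambda>x. f x * g x"
  have f': "(\<integral>\<^sup>+ x. ennreal (f x) \<partial>M) = \<infinity>" "(\<integral>\<^sup>+ x. ennreal (- f x) \<partial>M) < \<infinity>"
    using fg(1) f by (auto elim!: ext_integral_cases simp: ext_integral_integrable)
  \<comment> \<open>As \<open>0 * \<infinity> = 0\<close>, an infinite integral of the product makes
    the right-hand side infinite only when the total mass is positive.\<close>
  have space: "emeasure M (space M) \<noteq> 0"
  proof
    assume "emeasure M (space M) = 0"
    then have "(\<integral>\<^sup>+ x. ennreal (f x) \<partial>M) = 0"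
      by (simp add: nn_integral_0_iff_AE AE_null_space)
    then show False using f' by simp
  qed
  \<comment> \<open>In the first case the left-hand side is minus infinity, and in the second both
    sides are 0. In the third, \<open>g\<close> is positive on a non-null set, so the right-hand
    side is infinite.\<close>
  consider "ext_integral M g < 0" | "AE x in M. g x = 0"
    | "0 \<le> ext_integral M g" "\<not> (AE x in M. g x = 0)" by fastforce
  then show ?thesis
  proof cases
    case 1
    then show ?thesis by (cases "ext_integral M g") (auto simp: f)
  next
    case 2
    then have "AE x in M. ?fg x = 0" by eventually_elim simp
    have "ext_integral M h = 0" if "AE x in M. h x = 0" for h
    proof -
      have "(\<integral>\<^sup>+ x. ennreal (h x) \<partial>M) = (\<integral>\<^sup>+ x. 0 \<partial>M)" "(\<integral>\<^sup>+ x. ennreal (- h x) \<partial>M) = (\<integral>\<^sup>+ x. 0 \<partial>M)"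
        using that by (auto intro!: nn_integral_cong_AE simp del: nn_integral_const)
      then show ?thesis by (simp add: ext_integral_alt)
    qed
    with 2 \<open>AE x in M. ?fg x = 0\<close> show ?thesis by simp
  next
    case 3
    have neg: "(\<integral>\<^sup>+ x. ennreal (- g x) \<partial>M) < \<infinity>"
      using fg(2) 3(1) by (auto elim!: ext_integral_cases simp: real_integrable_def less_top)
    have "\<not> (AE x in M. g x \<le> 0)"
    proof
      assume le: "AE x in M. g x \<le> 0"
      then have "AE x in M. ennreal (g x) = 0" by eventually_elim (simp add: ennreal_neg)
      then have "(\<integral>\<^sup>+ x. ennreal (g x) \<partial>M) = 0" by (simp add: nn_integral_0_iff_AE)
      with 3(1) neg have "(\<integral>\<^sup>+ x. ennreal (- g x) \<partial>M) = 0"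
        by (cases "\<integral>\<^sup>+ x. ennreal (- g x) \<partial>M") (auto simp: ext_integral_alt zero_ennreal.rep_eq)
      then have "AE x in M. ennreal (- g x) = 0" by (simp add: nn_integral_0_iff_AE)
      with le have "AE x in M. g x = 0" by eventually_elim (simp add: ennreal_eq_0_iff)
      then show False using 3(2) by simp
    qed
    then have "ext_integral M ?fg = \<infinity>"
      by (intro ext_integral_mult_PInf corr f' neg) auto
    moreover have "0 < enn2ereal (emeasure M (space M))"
      using space by (metis enn2ereal_nonneg less_le enn2ereal_inject zero_ennreal.rep_eq)
    ultimately show ?thesis by auto
  qed
qed

lemma ext_integral_correlated:
  assumes corr: "AE_correlated M {f, g}"
    and fg: "ext_integrable M f" "ext_integrable M g" "ext_integrable M (\<lambda>x. f x * g x)"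
  shows "ext_integral M f * ext_integral M g
    \<le> enn2ereal (emeasure M (space M)) * ext_integral M (\<lambda>x. f x * g x)"
proof -
  have PInf: ?thesis if "ext_integral M f = \<infinity> \<or> ext_integral M g = \<infinity>"
    using that ext_integral_correlated_PInf[of f g] ext_integral_correlated_PInf[of g f] corr fg
    by (auto simp: insert_commute mult.commute)
  \<comment> \<open>Passing to \<open>- f\<close> and \<open>- g\<close> changes neither
    \<open>f x * g x\<close> nor the product of the two integrals, but turns minus infinity into
    plus infinity.\<close>
  have MInf: ?thesis if "ext_integral M f = - \<infinity> \<or> ext_integral M g = - \<infinity>"
    using that ext_integral_correlated_PInf[of "\<lambda>x. - f x" "\<lambda>x. - g x"]
      ext_integral_correlated_PInf[of "\<lambda>x. - g x" "\<lambda>x. - f x"]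
      AE_correlated_uminus[OF corr] fg
    by (auto simp: insert_commute mult.commute ext_integral_uminus)
  have ?thesis if int: "integrable M f" "integrable M g"
  proof (cases "integrable M (\<lambda>x. f x * g x)")
    case True
    then show ?thesis
      using integral_correlated(1)[OF corr int True]
      by (simp add: ext_integral_integrable int emeasure_eq_measure)
  next
    case False
    then have "ext_integral M (\<lambda>x. f x * g x) = \<infinity>"
      using ext_integral_mult_integrable_cases[OF corr int fg(3)] by simp
    moreover have "measure M (space M) \<noteq> 0"
    proof
      assume "measure M (space M) = 0"
      then have "AE x in M. f x * g x = 0" by (intro AE_null_space) (simp add: emeasure_eq_measure)
      then have "integrable M (\<lambda>x. f x * g x)"
        using ext_integrableD[OF fg(3)] by (subst integrable_cong_AE[where g = "\<lambda>x. 0"]) auto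
      then show False using False by blast
    qed
    ultimately show ?thesis
      by (simp add: ext_integral_integrable int emeasure_eq_measure measure_nonneg less_le)
  qed
  with PInf MInf show ?thesis
    using fg(1,2) by (cases rule: ext_integral_cases[OF fg(1)]; cases rule: ext_integral_cases[OF fg(2)]) blast+
qed

end

lemma (in finite_measure) ext_integral_correlated_eq_iff:
  assumes corr: "AE_correlated M {f, g}"
    and int: "integrable M f" "integrable M g"
    and fg: "ext_integrable M (\<lambda>x. f x * g x)"
  shows "enn2ereal (emeasure M (space M)) * ext_integral M (\<lambda>x. f x * g x)
      = ext_integral M f * ext_integral M g \<longleftrightarrow> AE_constant M f \<or> AE_constant M g"
    (is "?eq \<longleftrightarrow> ?const")
proof
  assume eq: ?eq
  show ?const
  proof (cases "emeasure M (space M) = 0")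
    case True
    then show ?thesis unfolding AE_constant_def using AE_null_space by blast
  next
    case False
    \<comment> \<open>With positive mass, an infinite integral of the product would make one side
      infinite while the other is a real number.\<close>
    then have "ext_integral M (\<lambda>x. f x * g x) \<noteq> \<infinity>"
      using eq by (auto simp: ext_integral_integrable int emeasure_eq_measure less_le split: if_splits)
    then have "integrable M (\<lambda>x. f x * g x)"
      using ext_integral_mult_integrable_cases[OF corr int fg] by blast
    then show ?thesis
      using eq integral_correlated(2)[OF corr int]
      by (simp add: ext_integral_integrable int emeasure_eq_measure)
  qed
next
  have eq: "enn2ereal (emeasure M (space M)) * ext_integral M (\<lambda>x. u x * v x)
      = ext_integral M u * ext_integral M v"
    if "AE_constant M u" "integrable M u" "integrable M v" for u v
  proof -
    note * = AE_constant_integrals[OF that(1) _ that(3)]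
    show ?thesis
      using that * by (simp add: ext_integral_integrable emeasure_eq_measure)
  qed
  assume ?const
  then show ?eq
    using eq[of f g] eq[of g f] int by (auto simp: mult.commute)
qed

section \<open>Products of finitely many nonnegative functions\<close>

lemma nn_integral_mult_prod_correlated:
  assumes "finite I" "AE_correlated M (insert h (f ` I))"
    and "h \<in> borel_measurable M" "\<And>i. i \<in> I \<Longrightarrow> f i \<in> borel_measurable M"
    and "\<And>x. x \<in> space M \<Longrightarrow> 0 \<le> h x" "\<And>i x. i \<in> I \<Longrightarrow> x \<in> space M \<Longrightarrow> 0 \<le> f i x"
  shows "(\<integral>\<^sup>+ x. ennreal (h x) \<partial>M) * (\<Prod>i\<in>I. \<integral>\<^sup>+ x. ennreal (f i x) \<partial>M)
    \<le> emeasure M (space M) ^ card I * (\<integral>\<^sup>+ x. ennreal (h x * (\<Prod>i\<in>I. f i x)) \<partial>M)"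
  using assms
\<comment> \<open>\<open>h\<close> must vary because it accumulates the factors already absorbed.
  Each absorption applies the two-function inequality once and costs one factor of the total
  mass.\<close>
proof (induction I arbitrary: h rule: finite_induct)
  case (insert i I)
  let ?m = "emeasure M (space M)" and ?h = "\<lambda>x. h x * f i x"
  let ?P = "\<Prod>i\<in>I. \<integral>\<^sup>+ x. ennreal (f i x) \<partial>M"
  have pair: "AE_correlated M {h, f i}"
    by (rule AE_correlated_mono[OF insert.prems(1)]) auto
  have rest: "AE_correlated M (insert ?h (f ` I))"
    using insert.prems by (intro AE_correlated_mult) auto
  have "(\<integral>\<^sup>+ x. ennreal (h x) \<partial>M) * (\<Prod>j\<in>insert i I. \<integral>\<^sup>+ x. ennreal (f j x) \<partial>M)
      = ((\<integral>\<^sup>+ x. ennreal (h x) \<partial>M) * (\<integral>\<^sup>+ x. ennreal (f i x) \<partial>M)) * ?P"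
    using insert.hyps by (simp add: mult.assoc)
  also have "\<dots> \<le> (?m * (\<integral>\<^sup>+ x. ennreal (?h x) \<partial>M)) * ?P"
    using insert.prems by (intro mult_right_mono nn_integral_correlated pair) auto
  also have "\<dots> = ?m * ((\<integral>\<^sup>+ x. ennreal (?h x) \<partial>M) * ?P)"
    by (simp add: mult.assoc)
  also have "\<dots> \<le> ?m * (?m ^ card I * (\<integral>\<^sup>+ x. ennreal (?h x * (\<Prod>i\<in>I. f i x)) \<partial>M))"
    using insert.prems by (intro mult_left_mono insert.IH rest) auto
  also have "\<dots> = ?m ^ card (insert i I)
      * (\<integral>\<^sup>+ x. ennreal (h x * (\<Prod>j\<in>insert i I. f j x)) \<partial>M)"
    using insert.hyps by (simp add: mult.assoc)
  finally show ?case .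
qed simp

text \<open>Each constant factor leaves the integral as \<open>ennreal (c i)\<close>, while its own
  integral is this value times the total mass. This accounts for one power of the mass per
  index.\<close>

lemma nn_integral_mult_prod_AE_constant:
  assumes I: "finite I" "\<And>i. i \<in> I \<Longrightarrow> AE_constant M (f i)"
    and [measurable]: "h \<in> borel_measurable M"
    and nonneg: "\<And>x. x \<in> space M \<Longrightarrow> 0 \<le> h x" "\<And>i x. i \<in> I \<Longrightarrow> x \<in> space M \<Longrightarrow> 0 \<le> f i x"
  shows "emeasure M (space M) ^ card I * (\<integral>\<^sup>+ x. ennreal (h x * (\<Prod>i\<in>I. f i x)) \<partial>M)
    = (\<integral>\<^sup>+ x. ennreal (h x) \<partial>M) * (\<Prod>i\<in>I. \<integral>\<^sup>+ x. ennreal (f i x) \<partial>M)"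
proof -
  let ?m = "emeasure M (space M)"
  obtain c where c: "\<And>i. i \<in> I \<Longrightarrow> AE x in M. f i x = c i"
    using I(2) unfolding AE_constant_def by metis
  have int: "(\<integral>\<^sup>+ x. ennreal (f i x) \<partial>M) = ennreal (c i) * ?m" if "i \<in> I" for i
  proof -
    have "(\<integral>\<^sup>+ x. ennreal (f i x) \<partial>M) = (\<integral>\<^sup>+ x. ennreal (c i) \<partial>M)"
      using c[OF that] by (intro nn_integral_cong_AE) auto
    then show ?thesis by simp
  qed
  have "AE x in M. \<forall>i\<in>I. f i x = c i"
    using I(1) c by (simp add: AE_finite_all)
  then have "AE x in M. ennreal (h x * (\<Prod>i\<in>I. f i x)) = ennreal (h x) * (\<Prod>i\<in>I. ennreal (c i))"
    using AE_space
  proof eventually_elim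
    case (elim x)
    have "ennreal (h x * (\<Prod>i\<in>I. f i x)) = ennreal (h x) * (\<Prod>i\<in>I. ennreal (f i x))"
      using nonneg elim(2) by (simp add: ennreal_mult prod_nonneg prod_ennreal)
    also have "(\<Prod>i\<in>I. ennreal (f i x)) = (\<Prod>i\<in>I. ennreal (c i))"
      using elim(1) by (intro prod.cong) auto
    finally show ?case .
  qed
  then have "(\<integral>\<^sup>+ x. ennreal (h x * (\<Prod>i\<in>I. f i x)) \<partial>M)
      = (\<integral>\<^sup>+ x. ennreal (h x) * (\<Prod>i\<in>I. ennreal (c i)) \<partial>M)"
    by (rule nn_integral_cong_AE)
  then show ?thesis
    by (simp add: nn_integral_multc int prod.distrib ac_simps)
qed

text \<open>A nonconstant function forces positive mass, so equality would make the integral of the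
  product finite. The identity then holds between real integrals, where the equality case makes
  \<open>f\<close> or \<open>g\<close> constant.\<close>

lemma (in finite_measure) nn_integral_correlated_strict:
  assumes corr: "AE_correlated M {f, g}"
    and [measurable]: "f \<in> borel_measurable M" "g \<in> borel_measurable M"
    and nonneg: "\<And>x. x \<in> space M \<Longrightarrow> 0 \<le> f x" "\<And>x. x \<in> space M \<Longrightarrow> 0 \<le> g x"
    and fin: "(\<integral>\<^sup>+ x. ennreal (f x) \<partial>M) < \<infinity>" "(\<integral>\<^sup>+ x. ennreal (g x) \<partial>M) < \<infinity>"
    and nc: "\<not> AE_constant M f" "\<not> AE_constant M g"
  shows "(\<integral>\<^sup>+ x. ennreal (f x) \<partial>M) * (\<integral>\<^sup>+ x. ennreal (g x) \<partial>M)
    < emeasure M (space M) * (\<integral>\<^sup>+ x. ennreal (f x * g x) \<partial>M)"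
proof (rule ccontr)
  let ?I = "\<lambda>h. \<integral>\<^sup>+ x. ennreal (h x) \<partial>M" and ?m = "emeasure M (space M)"
  assume "\<not> ?I f * ?I g < ?m * ?I (\<lambda>x. f x * g x)"
  then have eq: "?I f * ?I g = ?m * ?I (\<lambda>x. f x * g x)"
    using nn_integral_correlated[OF corr _ _ nonneg] by (simp add: antisym not_less)
  have "?m \<noteq> 0"
    using nc(1) AE_null_space[of M] unfolding AE_constant_def by blast
  moreover have "?m * ?I (\<lambda>x. f x * g x) < \<infinity>"
    using fin unfolding eq[symmetric] by (simp add: ennreal_mult_less_top)
  ultimately have "?I (\<lambda>x. f x * g x) < \<infinity>"
    by (auto simp add: ennreal_mult_less_top)
  moreover have I: "integrable M h \<and> ?I h = ennreal (\<integral>x. h x \<partial>M) \<and> 0 \<le> (\<integral>x. h x \<partial>M)"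
    if "h \<in> borel_measurable M" "\<And>x. x \<in> space M \<Longrightarrow> 0 \<le> h x" "?I h < \<infinity>" for h
  proof -
    have "integrable M h"
      using that by (intro integrableI_nonneg) auto
    then show ?thesis using that by (simp add: nn_integral_eq_integral integral_nonneg_AE)
  qed
  ultimately have fg: "integrable M (\<lambda>x. f x * g x)"
    "?I (\<lambda>x. f x * g x) = ennreal (\<integral>x. f x * g x \<partial>M)" "0 \<le> (\<integral>x. f x * g x \<partial>M)"
    using nonneg by auto
  have f: "integrable M f" "?I f = ennreal (\<integral>x. f x \<partial>M)" "0 \<le> (\<integral>x. f x \<partial>M)"
    and g: "integrable M g" "?I g = ennreal (\<integral>x. g x \<partial>M)" "0 \<le> (\<integral>x. g x \<partial>M)"
    using I nonneg fin by auto
  have "(\<integral>x. f x \<partial>M) * (\<integral>x. g x \<partial>M) = measure M (space M) * (\<integral>x. f x * g x \<partial>M)"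
    using eq f g fg by (simp add: emeasure_eq_measure ennreal_mult[symmetric])
  then show False
    using integral_correlated(2)[OF corr f(1) g(1) fg(1)] nc by simp
qed

text \<open>One member \<open>f j\<close> serves as the initial accumulator, which leaves
  \<open>card I - 1\<close> absorptions and explains the exponent.\<close>

lemma nn_integral_prod_correlated:
  assumes I: "finite I" "I \<noteq> {}" and corr: "AE_correlated M (f ` I)"
    and f: "\<And>i. i \<in> I \<Longrightarrow> f i \<in> borel_measurable M"
      "\<And>i x. i \<in> I \<Longrightarrow> x \<in> space M \<Longrightarrow> 0 \<le> f i x"
  shows "(\<Prod>i\<in>I. \<integral>\<^sup>+ x. ennreal (f i x) \<partial>M)
    \<le> emeasure M (space M) ^ (card I - 1) * (\<integral>\<^sup>+ x. ennreal (\<Prod>i\<in>I. f i x) \<partial>M)"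
proof -
  obtain j where j: "j \<in> I" using I by blast
  have "insert (f j) (f ` (I - {j})) = f ` I" using j by blast
  then show ?thesis
    using nn_integral_mult_prod_correlated[of "I - {j}" M "f j" f] I corr f j
    by (simp add: prod.remove[of I j])
qed

lemma (in finite_measure) nn_integral_prod_correlated_eq_iff:
  assumes I: "finite I" "I \<noteq> {}" and corr: "AE_correlated M (f ` I)"
    and f: "\<And>i. i \<in> I \<Longrightarrow> f i \<in> borel_measurable M"
      "\<And>i x. i \<in> I \<Longrightarrow> x \<in> space M \<Longrightarrow> 0 \<le> f i x"
    and fin: "\<And>i. i \<in> I \<Longrightarrow> 0 < (\<integral>\<^sup>+ x. ennreal (f i x) \<partial>M)"
      "\<And>i. i \<in> I \<Longrightarrow> (\<integral>\<^sup>+ x. ennreal (f i x) \<partial>M) < \<infinity>"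
  shows "emeasure M (space M) ^ (card I - 1) * (\<integral>\<^sup>+ x. ennreal (\<Prod>i\<in>I. f i x) \<partial>M)
      = (\<Prod>i\<in>I. \<integral>\<^sup>+ x. ennreal (f i x) \<partial>M)
    \<longleftrightarrow> card I - 1 \<le> card {i \<in> I. AE_constant M (f i)}" (is "?eq \<longleftrightarrow> ?const")
proof
  let ?m = "emeasure M (space M)" and ?A = "{i \<in> I. AE_constant M (f i)}"
  assume ?const
  \<comment> \<open>At most one member is nonconstant. It is chosen as \<open>j\<close>, or any
    index is if all are constant, and \<open>f j\<close> becomes the accumulator.\<close>
  obtain j where j: "j \<in> I" "I - {j} \<subseteq> ?A"
  proof (cases "?A = I")
    case True
    then show thesis using that I(2) by blast
  next
    case False
    then obtain j where j: "j \<in> I" "j \<notin> ?A" by blast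
    have "?A = I - {j}"
      using j I \<open>?const\<close> by (intro card_seteq) auto
    then show thesis using that j by blast
  qed
  show ?eq
    using nn_integral_mult_prod_AE_constant[of "I - {j}" M f "f j"] I f j
    by (simp add: prod.remove[of I j] subset_iff)
next
  let ?m = "emeasure M (space M)" and ?A = "{i \<in> I. AE_constant M (f i)}"
  assume eq: ?eq
  show ?const
  proof (rule ccontr)
    assume "\<not> ?const"
    moreover have "card (I - ?A) = card I - card ?A"
      using I by (intro card_Diff_subset) auto
    ultimately have "2 \<le> card (I - ?A)" by simp
    then obtain T where "T \<subseteq> I - ?A" "card T = 2"
      by (rule obtain_subset_with_card_n)
    then obtain a b where ab: "a \<in> I - ?A" "b \<in> I - ?A" "a \<noteq> b"
      by (auto simp: card_2_iff)
    define J where "J = I - {a} - {b}"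
    let ?P = "\<Prod>i\<in>J. \<integral>\<^sup>+ x. ennreal (f i x) \<partial>M"
    let ?h = "\<lambda>x. f a x * f b x"
    have J: "finite J" "J \<subseteq> I" and insert_J: "insert (f a) (insert (f b) (f ` J)) = f ` I"
      using I ab by (auto simp: J_def)
    have "card (I - {a}) = Suc (card J)"
      unfolding J_def using I ab by (intro card.remove) auto
    then have card_J: "card I - 1 = Suc (card J)" using I ab by simp
    \<comment> \<open>The type is left general because the rule splits both the
      \<open>ennreal\<close> product of the integrals and the real product of the functions.\<close>
    have split: "prod g I = g a * (g b * prod g J)" for g :: "_ \<Rightarrow> 'c::comm_monoid_mult"
      using I ab by (simp add: J_def prod.remove[of I a] prod.remove[of "I - {a}" b])
    \<comment> \<open>The remaining integrals are positive and finite, so multiplying by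
      \<open>?P\<close> preserves the strict inequality obtained from \<open>a\<close> and
      \<open>b\<close>.\<close>
    have "?P \<noteq> 0" "?P \<noteq> top"
      using J fin by (fastforce simp: ennreal_prod_eq_top)+
    then have P: "0 < ?P" "?P < top"
      by (simp_all add: zero_less_iff_neq_zero less_top)
    have "AE_correlated M {f a, f b}"
      by (rule AE_correlated_mono[OF corr]) (use ab in auto)
    then have strict: "(\<integral>\<^sup>+ x. ennreal (f a x) \<partial>M) * (\<integral>\<^sup>+ x. ennreal (f b x) \<partial>M)
        < ?m * (\<integral>\<^sup>+ x. ennreal (?h x) \<partial>M)"
      using ab f fin by (intro nn_integral_correlated_strict) auto
    have "AE_correlated M (insert ?h (f ` J))"
      using corr ab f unfolding insert_J[symmetric] by (intro AE_correlated_mult) auto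
    then have le: "(\<integral>\<^sup>+ x. ennreal (?h x) \<partial>M) * ?P
        \<le> ?m ^ card J * (\<integral>\<^sup>+ x. ennreal (?h x * (\<Prod>i\<in>J. f i x)) \<partial>M)"
      using J ab f by (intro nn_integral_mult_prod_correlated) auto
    have "(\<Prod>i\<in>I. \<integral>\<^sup>+ x. ennreal (f i x) \<partial>M)
        = ((\<integral>\<^sup>+ x. ennreal (f a x) \<partial>M) * (\<integral>\<^sup>+ x. ennreal (f b x) \<partial>M)) * ?P"
      by (simp add: split mult.assoc)
    also have "\<dots> < (?m * (\<integral>\<^sup>+ x. ennreal (?h x) \<partial>M)) * ?P"
      by (rule ennreal_mult_strict_right_mono[OF strict P])
    also have "\<dots> \<le> ?m * (?m ^ card J * (\<integral>\<^sup>+ x. ennreal (?h x * (\<Prod>i\<in>J. f i x)) \<partial>M))"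
      using le by (simp add: mult.assoc mult_left_mono)
    also have "\<dots> = ?m ^ (card I - 1) * (\<integral>\<^sup>+ x. ennreal (\<Prod>i\<in>I. f i x) \<partial>M)"
      unfolding card_J split by (simp add: mult.assoc)
    finally show False using eq by simp
  qed
qed

theorem theorem3p1:
  fixes M :: "'a measure"
  assumes "finite_measure M"
  shows "(\<forall>f g :: 'a \<Rightarrow> real.
            ext_integrable M f \<longrightarrow> ext_integrable M g \<longrightarrow>
            AE_correlated M {f, g} \<longrightarrow>
            ext_integrable M (\<lambda>x. f x * g x) \<longrightarrow>
            sets M = generated_sigma (space M) {f, g} \<longrightarrow>
              enn2ereal (emeasure M (space M)) * ext_integral M (\<lambda>x. f x * g x)
                \<ge> ext_integral M f * ext_integral M g \<and>
              (integrable M f \<and> integrable M g \<longrightarrow>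
                (enn2ereal (emeasure M (space M)) * ext_integral M (\<lambda>x. f x * g x)
                   = ext_integral M f * ext_integral M g
                 \<longleftrightarrow> AE_constant M f \<or> AE_constant M g)))
       \<and>
         (\<forall>(k::nat) (f :: nat \<Rightarrow> 'a \<Rightarrow> real).
            k > 0 \<longrightarrow>
            (\<forall>i\<in>{1..k}. f i \<in> borel_measurable M) \<longrightarrow>
            (\<forall>i\<in>{1..k}. \<forall>x\<in>space M. f i x \<ge> 0) \<longrightarrow>
            AE_correlated M (f ` {1..k}) \<longrightarrow>
            sets M = generated_sigma (space M) (f ` {1..k}) \<longrightarrow>
              emeasure M (space M) ^ (k - 1) * (\<integral>\<^sup>+ x. ennreal (\<Prod>i=1..k. f i x) \<partial>M)
                \<ge> (\<Prod>i=1..k. \<integral>\<^sup>+ x. ennreal (f i x) \<partial>M) \<and>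
              ((\<forall>i\<in>{1..k}. 0 < (\<integral>\<^sup>+ x. ennreal (f i x) \<partial>M) \<and> (\<integral>\<^sup>+ x. ennreal (f i x) \<partial>M) < \<infinity>) \<longrightarrow>
                (emeasure M (space M) ^ (k - 1) * (\<integral>\<^sup>+ x. ennreal (\<Prod>i=1..k. f i x) \<partial>M)
                   = (\<Prod>i=1..k. \<integral>\<^sup>+ x. ennreal (f i x) \<partial>M)
                 \<longleftrightarrow> card {i\<in>{1..k}. AE_constant M (f i)} \<ge> k - 1)))"
proof -
  interpret finite_measure M by fact
  show ?thesis
  proof (intro conjI allI impI)
    fix f g :: "'a \<Rightarrow> real"
    assume "ext_integrable M f" "ext_integrable M g" "AE_correlated M {f, g}"
      "ext_integrable M (\<lambda>x. f x * g x)"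
    then show "ext_integral M f * ext_integral M g
        \<le> enn2ereal (emeasure M (space M)) * ext_integral M (\<lambda>x. f x * g x)"
      by (intro ext_integral_correlated)
  next
    fix f g :: "'a \<Rightarrow> real"
    assume "AE_correlated M {f, g}" "ext_integrable M (\<lambda>x. f x * g x)"
      "integrable M f \<and> integrable M g"
    then show "enn2ereal (emeasure M (space M)) * ext_integral M (\<lambda>x. f x * g x)
        = ext_integral M f * ext_integral M g \<longleftrightarrow> AE_constant M f \<or> AE_constant M g"
      by (intro ext_integral_correlated_eq_iff) auto
  next
    fix k :: nat and f :: "nat \<Rightarrow> 'a \<Rightarrow> real"
    assume "0 < k" "\<forall>i\<in>{1..k}. f i \<in> borel_measurable M"
      "\<forall>i\<in>{1..k}. \<forall>x\<in>space M. 0 \<le> f i x" "AE_correlated M (f ` {1..k})"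
    then show "(\<Prod>i=1..k. \<integral>\<^sup>+ x. ennreal (f i x) \<partial>M)
        \<le> emeasure M (space M) ^ (k - 1) * (\<integral>\<^sup>+ x. ennreal (\<Prod>i=1..k. f i x) \<partial>M)"
      using nn_integral_prod_correlated[of "{1..k}" M f] by simp
  next
    fix k :: nat and f :: "nat \<Rightarrow> 'a \<Rightarrow> real"
    assume "0 < k" "\<forall>i\<in>{1..k}. f i \<in> borel_measurable M"
      "\<forall>i\<in>{1..k}. \<forall>x\<in>space M. 0 \<le> f i x" "AE_correlated M (f ` {1..k})"
      "\<forall>i\<in>{1..k}. 0 < (\<integral>\<^sup>+ x. ennreal (f i x) \<partial>M) \<and> (\<integral>\<^sup>+ x. ennreal (f i x) \<partial>M) < \<infinity>"
    then show "emeasure M (space M) ^ (k - 1) * (\<integral>\<^sup>+ x. ennreal (\<Prod>i=1..k. f i x) \<partial>M)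
        = (\<Prod>i=1..k. \<integral>\<^sup>+ x. ennreal (f i x) \<partial>M)
        \<longleftrightarrow> k - 1 \<le> card {i\<in>{1..k}. AE_constant M (f i)}"
      using nn_integral_prod_correlated_eq_iff[of "{1..k}" f] by simp
  qed
qed

end
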